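(* Let $f:\mathbb{X}\to\mathbb{R}$ be a finite measurable function such that $\lim_n B_nf=c$ $\mu$-a.e. with $c\in\mathbb{R}$ finite. Then neither the set of points $x$ for which $B_nf(x)-c>0$ for all sufficiently large $n$, nor the set of points $x$ for which $B_nf(x)-c<0$ for all sufficiently large $n$, has positive measure. That is, $\mu\big(\bigcup_{N>0}\bigcap_{n>N}\{B_nf>c\}\big)=0$ and $\mu\big(\bigcup_{N>0}\bigcap_{n>N}\{B_nf<c\}\big)=0$.
   Context: Standing assumptions: $(\mathbb{X},\mathcal{X},\mu,T)$ is a probability space with $T$ an invertible, bi-measurable, measure-preserving, ergodic transformation. $B_nf=\frac{1}{2n+1}\sum_{i=-n}^{n}f\circ T^i$. *)

theory Defs
  imports "HOL-Probability.Probability"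
begin

definition inv_mp :: "'a measure \<Rightarrow> ('a \<Rightarrow> 'a) \<Rightarrow> bool" where
  "inv_mp M T \<longleftrightarrow>
     bij_betw T (space M) (space M) \<and>
     T \<in> M \<rightarrow>\<^sub>M M \<and>
     inv_into (space M) T \<in> M \<rightarrow>\<^sub>M M \<and>
     (\<forall>A \<in> sets M. emeasure M (T -` A \<inter> space M) = emeasure M A)"

definition ergodic :: "'a measure \<Rightarrow> ('a \<Rightarrow> 'a) \<Rightarrow> bool" where
  "ergodic M T \<longleftrightarrow>
     (\<forall>A \<in> sets M. T -` A \<inter> space M = A \<longrightarrow> emeasure M A = 0 \<or> emeasure M A = emeasure M (space M))"

definition Tpow :: "'a measure \<Rightarrow> ('a \<Rightarrow> 'a) \<Rightarrow> int \<Rightarrow> 'a \<Rightarrow> 'a" where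
  "Tpow M T i = (if 0 \<le> i then T ^^ nat i else inv_into (space M) T ^^ nat (- i))"

definition Bavg :: "'a measure \<Rightarrow> ('a \<Rightarrow> 'a) \<Rightarrow> ('a \<Rightarrow> real) \<Rightarrow> nat \<Rightarrow> 'a \<Rightarrow> real" where
  "Bavg M T f n x = (\<Sum>i\<in>{- int n..int n}. f (Tpow M T i x)) / (2 * real n + 1)"

end

theory Submission
  imports Defs
begin

text \<open>
  Take \<open>c = 0\<close>, let \<open>E\<close> be the set where \<open>B\<^sub>n f > 0\<close> for all \<open>n > N\<close>, and suppose it has positive measure.
  Along an orbit let \<open>F\<close> be the walk with increments \<open>f (T\<^sup>i x)\<close>; the two-sided sum of radius \<open>n\<close>
  centred at \<open>k\<close> is \<open>F (k + n + 1) - F (k - n)\<close>. Hence at a visit \<open>k\<close> to \<open>E\<close> the reflection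
  \<open>a \<mapsto> 2 k + 1 - a\<close> of any \<open>a < k - N\<close> increases \<open>F\<close>. Iterating reflections in
  the first available visit gives an increasing chain along which \<open>F\<close> increases. All but a
  small fraction of the starting points have a jump of bounded length whose gain exceeds a fixed
  \<open>\<eta>\<close>; since the points of the chain are distinct, \<open>F\<close> grows linearly along it. On the
  other hand \<open>B\<^sub>n f \<longlonglongrightarrow> 0\<close> makes the two-sided sums centred at most points small compared
  with their length, and reflecting both ends of the chain to a common third point shows that the
  growth is sublinear. As \<open>f\<close> need not be integrable, the exceptional points are counted with
  Markov's inequality on a finite window instead of the ergodic theorem.
\<close>

section \<open>Deterministic part: reflections of a walk indexed by the integers\<close>

lemma exists_least_int_ge:
  fixes S :: "int set"
  assumes "k0 \<in> S" "a \<le> k0"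
  obtains k where "k \<in> S" "a \<le> k" "\<And>j. j \<in> S \<Longrightarrow> a \<le> j \<Longrightarrow> k \<le> j"
proof -
  define n where "n = (LEAST n. a + int n \<in> S)"
  have ex: "a + int (nat (k0 - a)) \<in> S" using assms by simp
  have "a + int n \<in> S" unfolding n_def by (rule LeastI, rule ex)
  moreover have "a + int n \<le> j" if "j \<in> S" "a \<le> j" for j
  proof -
    have "a + int (nat (j - a)) \<in> S" using that by simp
    then have "n \<le> nat (j - a)" unfolding n_def by (rule Least_le)
    then show ?thesis using that by linarith
  qed
  ultimately show ?thesis using that[of "a + int n"] by simp
qed

text \<open>The weight \<open>\<phi>\<close> penalises exceptional points: \<open>6\<close> before a gap, to outweigh the length of the
  jump over it, and \<open>5 * D\<close> where a short jump (of length at most \<open>4 * D + 1\<close>) gains too little.\<close>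

locale reflected_walk =
  fixes F \<phi> :: "int \<Rightarrow> real" and E :: "int set" and N D :: int and \<eta> :: real
  assumes N_nonneg: "0 \<le> N" and D_pos: "0 < D" and \<eta>_pos: "0 < \<eta>"
    and reflect: "\<And>k a. k \<in> E \<Longrightarrow> a + N \<le> k \<Longrightarrow> F a < F (2 * k + 1 - a)"
    and visits: "\<And>a. \<exists>k\<in>E. a \<le> k"
    and \<phi>_nonneg: "\<And>a. 0 \<le> \<phi> a"
    and \<phi>_gap: "\<And>a. (\<And>k. a + N \<le> k \<Longrightarrow> k \<le> a + D \<Longrightarrow> k \<notin> E) \<Longrightarrow> 6 \<le> \<phi> a"
    and \<phi>_small: "\<And>a k. k \<in> E \<Longrightarrow> a + N \<le> k \<Longrightarrow> k \<le> a + 2 * D \<Longrightarrow>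
          F (2 * k + 1 - a) - F a \<le> \<eta> \<Longrightarrow> 5 * real_of_int D \<le> \<phi> a"
begin

text \<open>The slope guaranteed by a good short jump: it gains more than \<open>\<eta>\<close> over
  a length of at most \<open>4 * D + 1\<close>, hence at most \<open>5 * D\<close>.\<close>

definition rate :: real where "rate = \<eta> / (5 * D)"

lemma rate_pos: "0 < rate"
  using D_pos \<eta>_pos by (simp add: rate_def)

lemma sum_\<phi>_ge_gap:
  assumes "\<And>i. a \<le> i \<Longrightarrow> i < b \<Longrightarrow> 6 \<le> \<phi> i" "a \<le> b" "b \<le> c"
  shows "6 * real_of_int (b - a) \<le> (\<Sum>i\<in>{a..<c}. \<phi> i)"
proof -
  have "6 * real_of_int (b - a) = (\<Sum>i\<in>{a..<b}. 6)" using assms(2) by simp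
  also have "\<dots> \<le> (\<Sum>i\<in>{a..<b}. \<phi> i)" by (rule sum_mono) (use assms in auto)
  also have "\<dots> \<le> (\<Sum>i\<in>{a..<c}. \<phi> i)" by (rule sum_mono2) (use assms \<phi>_nonneg in auto)
  finally show ?thesis .
qed

text \<open>The jump reflects \<open>a\<close> in the first admissible visit \<open>k\<close>. A jump of length more than
  \<open>4 * D + 1\<close> spans a gap between visits of comparable length, on which \<open>\<phi> \<ge> 6\<close>.\<close>

lemma jump:
  obtains b where "a < b" "odd (b - a)"
    "rate * (real_of_int (b - a) - (\<Sum>i\<in>{a..<b}. \<phi> i)) \<le> F b - F a"
    "\<And>L. a < L \<Longrightarrow> 4 * D + 1 < b - a \<Longrightarrow>
       (\<Sum>i\<in>{a..<L}. \<phi> i) < 6 * real_of_int (L - a) \<Longrightarrow> real_of_int (b - a) \<le> (\<Sum>i\<in>{a..<L}. \<phi> i)"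
proof -
  obtain k0 where "k0 \<in> E" "a + N \<le> k0" using visits by blast
  then obtain k where k: "k \<in> E" "a + N \<le> k" "\<And>j. j \<in> E \<Longrightarrow> a + N \<le> j \<Longrightarrow> k \<le> j"
    by (rule exists_least_int_ge) blast
  define b where "b = 2 * k + 1 - a"
  have gt: "F a < F b" unfolding b_def by (rule reflect) (use k in auto)
  have ab: "a < b" using k(2) N_nonneg by (simp add: b_def)
  \<comment> \<open>Minimality of \<open>k\<close> leaves no visit from \<open>a + N\<close> up to
    \<open>k - 1\<close>, and for these \<open>i\<close> the range from \<open>i + N\<close> to
    \<open>i + D\<close> lies inside.\<close>
  have gap: "6 \<le> \<phi> i" if "a \<le> i" "i < k - D" for i
  proof (rule \<phi>_gap)
    fix j assume "i + N \<le> j" "j \<le> i + D"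
    then show "j \<notin> E" using k(3)[of j] that by linarith
  qed
  have s0: "\<phi> a \<le> (\<Sum>i\<in>{a..<b}. \<phi> i)"
    by (rule member_le_sum) (use ab \<phi>_nonneg in auto)
  have gain: "rate * (real_of_int (b - a) - (\<Sum>i\<in>{a..<b}. \<phi> i)) \<le> F b - F a"
  proof -
    \<comment> \<open>In \<open>small\<close> and \<open>big\<close> the penalty covers the whole
      length \<open>b - a\<close>, so the left side is at most 0 and \<open>gt\<close> suffices.
      Only \<open>good\<close> needs the gain \<open>\<eta>\<close>, which is
      \<open>rate * (5 * D)\<close>.\<close>
    consider (small) "k - a \<le> 2 * D" "F b - F a \<le> \<eta>" | (good) "k - a \<le> 2 * D" "\<eta> < F b - F a"
      | (big) "2 * D < k - a" by linarith
    then show ?thesis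
    proof cases
      case small
      have "5 * real_of_int D \<le> \<phi> a"
        using small k by (intro \<phi>_small[of k]) (auto simp: b_def)
      moreover have "b - a \<le> 5 * D" using small(1) D_pos by (simp add: b_def)
      then have "real_of_int (b - a) \<le> 5 * real_of_int D" by linarith
      ultimately have "real_of_int (b - a) - (\<Sum>i\<in>{a..<b}. \<phi> i) \<le> 0" using s0 by linarith
      then have "rate * (real_of_int (b - a) - (\<Sum>i\<in>{a..<b}. \<phi> i)) \<le> 0"
        using rate_pos by (simp add: mult_le_0_iff)
      then show ?thesis using gt by linarith
    next
      case good
      have "b - a \<le> 5 * D" using good(1) D_pos by (simp add: b_def)
      then have "real_of_int (b - a) \<le> 5 * real_of_int D" by linarith
      then have "real_of_int (b - a) - (\<Sum>i\<in>{a..<b}. \<phi> i) \<le> 5 * real_of_int D"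
        using s0 \<phi>_nonneg[of a] by linarith
      then have "rate * (real_of_int (b - a) - (\<Sum>i\<in>{a..<b}. \<phi> i)) \<le> rate * (5 * real_of_int D)"
        using rate_pos by (intro mult_left_mono) auto
      also have "\<dots> = \<eta>" using D_pos by (simp add: rate_def)
      finally show ?thesis using good(2) by linarith
    next
      case big
      have "6 * real_of_int (k - D - a) \<le> (\<Sum>i\<in>{a..<b}. \<phi> i)"
        using big D_pos by (intro sum_\<phi>_ge_gap gap) (auto simp: b_def)
      moreover have "b - a \<le> 6 * (k - D - a)" using big D_pos by (simp add: b_def)
      then have "real_of_int (b - a) \<le> 6 * real_of_int (k - D - a)" by linarith
      ultimately have "real_of_int (b - a) - (\<Sum>i\<in>{a..<b}. \<phi> i) \<le> 0" by linarith
      then have "rate * (real_of_int (b - a) - (\<Sum>i\<in>{a..<b}. \<phi> i)) \<le> 0"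
        using rate_pos by (simp add: mult_le_0_iff)
      then show ?thesis using gt by linarith
    qed
  qed
  have long: "real_of_int (b - a) \<le> (\<Sum>i\<in>{a..<L}. \<phi> i)"
    if L: "a < L" "4 * D + 1 < b - a" "(\<Sum>i\<in>{a..<L}. \<phi> i) < 6 * real_of_int (L - a)" for L
  proof -
    have big: "2 * D < k - a" using L(2) by (simp add: b_def)
    \<comment> \<open>Cutting the gap at \<open>L\<close> keeps the penalty sum inside the window. A
      gap reaching \<open>L\<close> would cost \<open>6 * (L - a)\<close>, contrary to the bound on
      that sum.\<close>
    define e where "e = min (k - D) L"
    have "6 * real_of_int (e - a) \<le> (\<Sum>i\<in>{a..<L}. \<phi> i)"
      using big D_pos L(1) by (intro sum_\<phi>_ge_gap gap) (auto simp: e_def)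
    then have "e = k - D" using L(3) by (auto simp: e_def min_def split: if_splits)
    moreover have "b - a \<le> 6 * (k - D - a)" using big D_pos by (simp add: b_def)
    then have "real_of_int (b - a) \<le> 6 * real_of_int (k - D - a)" by linarith
    ultimately show ?thesis using \<open>6 * real_of_int (e - a) \<le> _\<close> by simp
  qed
  have "odd (b - a)" by (simp add: b_def)
  then show ?thesis by (rule that[OF ab _ gain long])
qed

lemma sum_\<phi>_mono: "A \<subseteq> B \<Longrightarrow> finite B \<Longrightarrow> sum \<phi> A \<le> sum \<phi> B"
  by (rule sum_mono2) (use \<phi>_nonneg in auto)

text \<open>Penalties are controlled only on the window, so jumps must not leave it. A long jump is
  no longer than the total penalty, at most \<open>L / 32\<close>; a short one has length at most
  \<open>5 * D\<close>, again at most \<open>L / 32\<close>.\<close>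

lemma jump_in_window:
  assumes "0 \<le> a" "2 * a < L" "160 * D \<le> L" and tot: "(\<Sum>i\<in>{-L..<L}. \<phi> i) \<le> L / 32"
  obtains b where "a < b" "odd (b - a)" "32 * (b - a) \<le> L"
    "rate * (real_of_int (b - a) - (\<Sum>i\<in>{a..<b}. \<phi> i)) \<le> F b - F a"
proof -
  obtain b where b: "a < b" "odd (b - a)"
    "rate * (real_of_int (b - a) - (\<Sum>i\<in>{a..<b}. \<phi> i)) \<le> F b - F a"
    "\<And>L. a < L \<Longrightarrow> 4 * D + 1 < b - a \<Longrightarrow>
       (\<Sum>i\<in>{a..<L}. \<phi> i) < 6 * real_of_int (L - a) \<Longrightarrow> real_of_int (b - a) \<le> (\<Sum>i\<in>{a..<L}. \<phi> i)"
    by (rule jump[of a], rule that, assumption+)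
  have s: "(\<Sum>i\<in>{a..<L}. \<phi> i) \<le> L / 32"
    using sum_\<phi>_mono[of "{a..<L}" "{-L..<L}"] assms by auto
  have "32 * (b - a) \<le> L"
  proof (cases "4 * D + 1 < b - a")
    case True
    have "L \<le> 2 * (L - a)" using assms(2) by simp
    then have "real_of_int L \<le> 2 * real_of_int (L - a)" by linarith
    then have "real_of_int (b - a) \<le> L / 32" using s b(4)[of L] True assms by linarith
    then have "real_of_int (32 * (b - a)) \<le> real_of_int L" by (simp add: field_simps)
    then show ?thesis by linarith
  next
    case False
    then have "32 * (b - a) \<le> 128 * D + 32" by simp
    then show ?thesis using assms(3) D_pos by linarith
  qed
  then show ?thesis by (rule that[OF b(1,2) _ b(3)])
qed

text \<open>Every jump changes the parity, so an even end point is reached by double jumps.\<close>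

lemma chain:
  assumes "160 * D \<le> L" and tot: "(\<Sum>i\<in>{-L..<L}. \<phi> i) \<le> L / 32"
  obtains h where "L \<le> 8 * h" "32 * h \<le> 5 * L" "rate * (L / 8) \<le> F (2 * h) - F 0"
proof -
  \<comment> \<open>The bound \<open>32 * h \<le> 5 * L\<close> allows one overshoot: from
    \<open>2 * h < L / 4\<close>, two jumps of length at most \<open>L / 32\<close> end below
    \<open>5 * L / 16\<close>. It also makes the candidates finite, so a maximal \<open>h\<close>
    can replace the iteration of jumps.\<close>
  define Q where "Q h \<longleftrightarrow> 0 \<le> h \<and> 32 * h \<le> 5 * L \<and>
    rate * (2 * real_of_int h - (\<Sum>i\<in>{0..<2 * h}. \<phi> i)) \<le> F (2 * h) - F 0" for h
  have L0: "0 < L" using assms D_pos by linarith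
  have "{h. Q h} \<subseteq> {0..5 * L}" by (auto simp: Q_def)
  then have fin: "finite {h. Q h}" by (rule finite_subset) simp
  have "Q 0" using L0 by (simp add: Q_def)
  define h where "h = Max {h. Q h}"
  have "Q h" using fin \<open>Q 0\<close> Max_in[of "{h. Q h}"] by (auto simp: h_def)
  have max: "h' \<le> h" if "Q h'" for h' using fin that by (simp add: h_def)
  have "L \<le> 8 * h"
  proof (rule ccontr)
    assume "\<not> L \<le> 8 * h"
    then have h: "8 * h < L" "0 \<le> h" using \<open>Q h\<close> by (auto simp: Q_def)
    obtain b where b: "2 * h < b" "odd (b - 2 * h)" "32 * (b - 2 * h) \<le> L"
      "rate * (real_of_int (b - 2 * h) - (\<Sum>i\<in>{2 * h..<b}. \<phi> i)) \<le> F b - F (2 * h)"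
      using jump_in_window[of "2 * h" L] h assms by (auto)
    obtain d where d: "b < d" "odd (d - b)" "32 * (d - b) \<le> L"
      "rate * (real_of_int (d - b) - (\<Sum>i\<in>{b..<d}. \<phi> i)) \<le> F d - F b"
      using jump_in_window[of b L] b h assms by (auto)
    from b d have "even d" by auto
    then obtain h' where h': "d = 2 * h'" by blast
    have "(\<Sum>i\<in>{0..<d}. \<phi> i) = (\<Sum>i\<in>{0..<2 * h}. \<phi> i) + (\<Sum>i\<in>{2 * h..<b}. \<phi> i) + (\<Sum>i\<in>{b..<d}. \<phi> i)"
      using h b d by (simp add: sum.union_disjoint[symmetric] ivl_disj_un ivl_disj_int)
    then have "rate * (d - (\<Sum>i\<in>{0..<d}. \<phi> i)) =
      rate * (2 * real_of_int h - (\<Sum>i\<in>{0..<2 * h}. \<phi> i)) +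
      rate * (real_of_int (b - 2 * h) - (\<Sum>i\<in>{2 * h..<b}. \<phi> i)) + rate * (real_of_int (d - b) - (\<Sum>i\<in>{b..<d}. \<phi> i))"
      by (simp add: algebra_simps)
    also have "\<dots> \<le> F d - F 0" using b(4) d(4) \<open>Q h\<close> by (auto simp: Q_def)
    finally have "Q h'" using h b d h' by (auto simp: Q_def)
    then show False using max[of h'] b d h' by linarith
  qed
  moreover have "rate * (L / 8) \<le> F (2 * h) - F 0"
  proof -
    have "(\<Sum>i\<in>{0..<2 * h}. \<phi> i) \<le> L / 32"
      using sum_\<phi>_mono[of "{0..<2 * h}" "{-L..<L}"] tot \<open>Q h\<close> by (auto simp: Q_def)
    moreover have "real_of_int L / 4 \<le> 2 * real_of_int h" using \<open>L \<le> 8 * h\<close> by linarith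
    moreover have "0 < real_of_int L" using L0 by simp
    ultimately have "L / 8 \<le> 2 * real_of_int h - (\<Sum>i\<in>{0..<2 * h}. \<phi> i)" by linarith
    then have "rate * (L / 8) \<le> rate * (2 * real_of_int h - (\<Sum>i\<in>{0..<2 * h}. \<phi> i))"
      using rate_pos by (intro mult_left_mono) auto
    then show ?thesis using \<open>Q h\<close> by (auto simp: Q_def)
  qed
  ultimately show ?thesis using that[of h] \<open>Q h\<close> by (auto simp: Q_def)
qed

text \<open>Reflecting both end points of the chain to a common point \<open>2 * k + 1\<close>, through
  centres \<open>k\<close> and \<open>k + h\<close> at which \<open>\<phi> < 1\<close>, bounds its total gain.\<close>

lemma no_small_reflections:
  assumes "160 * D \<le> L" "8 * (int m + 1) \<le> L" "\<epsilon> < rate / 32" "0 < \<epsilon>"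
    and tot: "(\<Sum>i\<in>{-L..<L}. \<phi> i) \<le> L / 32"
    and good: "\<And>k n. \<phi> k < 1 \<Longrightarrow> m \<le> n \<Longrightarrow> \<bar>F (k + int n + 1) - F (k - int n)\<bar> \<le> \<epsilon> * (2 * real n + 1)"
  shows False
proof -
  obtain h where h: "L \<le> 8 * h" "32 * h \<le> 5 * L" "rate * (L / 8) \<le> F (2 * h) - F 0"
    using chain[OF assms(1) tot] by blast
  have L0: "0 < L" using assms D_pos by linarith
  \<comment> \<open>For \<open>k < - h\<close> both radii below are at least \<open>h\<close>, hence
    at least \<open>m\<close>. Of the \<open>3 * h \<ge> 3 * L / 8\<close> candidates not all can
    fail, since the penalties at \<open>k\<close> and \<open>k + h\<close> add up to at most
    \<open>L / 16\<close> over \<open>K\<close>.\<close>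
  define K where "K = {- (4 * h)..<- h}"
  have "\<exists>k\<in>K. \<phi> k < 1 \<and> \<phi> (k + h) < 1"
  proof (rule ccontr)
    assume "\<not> ?thesis"
    then have *: "1 \<le> \<phi> k + \<phi> (k + h)" if "k \<in> K" for k
      using that \<phi>_nonneg[of k] \<phi>_nonneg[of "k + h"] by force
    have "real_of_int (3 * h) = (\<Sum>k\<in>K. 1)" using h L0 by (simp add: K_def)
    also have "\<dots> \<le> (\<Sum>k\<in>K. \<phi> k + \<phi> (k + h))" by (rule sum_mono) (rule *)
    also have "\<dots> = (\<Sum>k\<in>K. \<phi> k) + (\<Sum>k\<in>(\<lambda>k. k + h) ` K. \<phi> k)"
      by (simp add: sum.distrib sum.reindex)
    also have "\<dots> \<le> L / 32 + L / 32"
      by (intro add_mono order.trans[OF sum_\<phi>_mono tot]) (use h in \<open>auto simp: K_def\<close>)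
    finally show False using h L0 by linarith
  qed
  then obtain k where k: "k \<in> K" "\<phi> k < 1" "\<phi> (k + h) < 1" by blast
  \<comment> \<open>With these radii the block centred at \<open>k\<close> joins
    \<open>2 * k + 1\<close> to \<open>0\<close>, and the one centred at \<open>k + h\<close> joins
    \<open>2 * k + 1\<close> to \<open>2 * h\<close>.\<close>
  define n1 n2 where "n1 = nat (- k - 1)" and "n2 = nat (h - k - 1)"
  have n: "int n1 = - k - 1" "int n2 = h - k - 1" "m \<le> n1" "m \<le> n2"
    using k(1) h assms(2) L0 by (auto simp: n1_def n2_def K_def)
  have "int n1 \<le> L - 1" "int n2 \<le> L - 1" using n(1,2) k(1) h by (auto simp: K_def)
  then have le: "2 * real n1 + 1 \<le> 2 * real_of_int L" "2 * real n2 + 1 \<le> 2 * real_of_int L"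
    by linarith+
  have "\<bar>F 0 - F (2 * k + 1)\<bar> \<le> \<epsilon> * (2 * real n1 + 1)"
    using good[OF k(2) n(3)] unfolding n(1) by (simp add: algebra_simps)
  also have "\<dots> \<le> \<epsilon> * (2 * real_of_int L)" using le assms(4) by (intro mult_left_mono) auto
  finally have 1: "\<bar>F 0 - F (2 * k + 1)\<bar> \<le> \<epsilon> * (2 * real_of_int L)" .
  have "\<bar>F (2 * h) - F (2 * k + 1)\<bar> \<le> \<epsilon> * (2 * real n2 + 1)"
    using good[OF k(3) n(4)] unfolding n(2) by (simp add: algebra_simps)
  also have "\<dots> \<le> \<epsilon> * (2 * real_of_int L)" using le assms(4) by (intro mult_left_mono) auto
  finally have 2: "\<bar>F (2 * h) - F (2 * k + 1)\<bar> \<le> \<epsilon> * (2 * real_of_int L)" .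
  have "\<epsilon> * (4 * real_of_int L) < (rate / 32) * (4 * real_of_int L)"
    using assms(3) L0 by (intro mult_strict_right_mono) auto
  then show False using 1 2 h(3) by (simp add: algebra_simps)
qed

end

section \<open>Probabilistic tools\<close>

lemma distr_funpow_eq_self:
  assumes "g \<in> M \<rightarrow>\<^sub>M M" "distr M M g = M"
  shows "g ^^ n \<in> M \<rightarrow>\<^sub>M M \<and> distr M M (g ^^ n) = M"
proof (induction n)
  case 0
  then show ?case by (simp add: id_def)
next
  case (Suc n)
  have "distr M M (g ^^ Suc n) = distr (distr M M (g ^^ n)) M g"
    using Suc assms(1) by (subst distr_distr) auto
  also have "\<dots> = M" using Suc assms(2) by simp
  finally have "distr M M (g ^^ Suc n) = M" .
  moreover have "g ^^ Suc n \<in> M \<rightarrow>\<^sub>M M"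
    using Suc assms(1) by (simp add: measurable_comp)
  ultimately show ?case by blast
qed

text \<open>Dominated convergence for the indicators, with bound 1.\<close>

lemma (in prob_space) prob_tendsto_zero:
  assumes [measurable]: "\<And>n. A n \<in> sets M" and "AE x in M. eventually (\<lambda>n. x \<notin> A n) sequentially"
  shows "(\<lambda>n. prob (A n)) \<longlonglongrightarrow> 0"
proof -
  have "(\<lambda>n. integral\<^sup>L M (indicator (A n) :: _ \<Rightarrow> real)) \<longlonglongrightarrow> integral\<^sup>L M (\<lambda>x. 0)"
  proof (rule integral_dominated_convergence[where w = "\<lambda>_. 1"])
    show "AE x in M. (\<lambda>n. indicator (A n) x :: real) \<longlonglongrightarrow> 0"
      using assms(2)
    proof eventually_elim
      case (elim x)
      then show ?case
        by (intro tendsto_eventually) (auto elim!: eventually_mono)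
    qed
  qed (auto simp: indicator_def)
  then show ?thesis by simp
qed

lemma (in prob_space) exists_prob_less:
  assumes "\<And>n. A n \<in> sets M" "AE x in M. eventually (\<lambda>n. x \<notin> A n) sequentially" "0 < e"
  obtains n :: nat where "n0 \<le> n" "prob (A n) < e"
proof -
  have "eventually (\<lambda>n. prob (A n) < e) sequentially"
    using prob_tendsto_zero[OF assms(1,2)] assms(3) by (auto dest: order_tendstoD)
  then have "eventually (\<lambda>n. prob (A n) < e \<and> n0 \<le> n) sequentially"
    using eventually_ge_at_top by (rule eventually_conj)
  then show ?thesis using that by (auto dest: eventually_happens)
qed

text \<open>Picks one orbit with both an almost sure property and an averaged bound: otherwise
  \<open>g\<close> would exceed its own mean almost everywhere.\<close>

lemma (in prob_space) exists_le_expectation: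
  fixes g :: "'a \<Rightarrow> real"
  assumes "integrable M g" "AE x in M. R x"
  obtains x where "x \<in> space M" "R x" "g x \<le> expectation g"
proof (rule ccontr)
  assume "\<not> thesis"
  then have *: "x \<in> space M \<Longrightarrow> R x \<Longrightarrow> expectation g < g x" for x
    using that by force
  have "AE x in M. expectation g < g x"
    using assms(2) AE_space by eventually_elim (rule *)
  then have "expectation (\<lambda>_. expectation g) < expectation g"
    using assms(1) by (intro integral_less_AE_space) (auto simp: emeasure_space_1)
  then show False by (simp add: prob_space)
qed

section \<open>Two-sided orbits and recurrence\<close>

locale invertible_ergodic = prob_space M for M :: "'a measure" +
  fixes T :: "'a \<Rightarrow> 'a"
  assumes inv_mp: "inv_mp M T" and ergodic: "ergodic M T"
begin

abbreviation U :: "int \<Rightarrow> 'a \<Rightarrow> 'a" where "U \<equiv> Tpow M T"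

lemma T_bij: "bij_betw T (space M) (space M)"
  and T_measurable: "T \<in> M \<rightarrow>\<^sub>M M"
  and Tinv_measurable: "inv_into (space M) T \<in> M \<rightarrow>\<^sub>M M"
  and T_emeasure: "A \<in> sets M \<Longrightarrow> emeasure M (T -` A \<inter> space M) = emeasure M A"
  using inv_mp by (auto simp: inv_mp_def)

lemma T_space: "x \<in> space M \<Longrightarrow> T x \<in> space M"
  using T_bij by (auto simp: bij_betw_def)

lemma Tinv_space: "x \<in> space M \<Longrightarrow> inv_into (space M) T x \<in> space M"
  using Tinv_measurable by (rule measurable_space)

lemma T_Tinv: "x \<in> space M \<Longrightarrow> T (inv_into (space M) T x) = x"
  using T_bij by (metis bij_betw_inv_into_right)

lemma Tinv_T: "x \<in> space M \<Longrightarrow> inv_into (space M) T (T x) = x"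
  using T_bij by (metis bij_betw_inv_into_left)

lemma distr_T: "distr M M T = M"
  by (rule measure_eqI) (simp_all add: emeasure_distr T_measurable T_emeasure)

lemma distr_Tinv: "distr M M (inv_into (space M) T) = M"
proof -
  have "distr M M (inv_into (space M) T) = distr (distr M M T) M (inv_into (space M) T)"
    by (simp add: distr_T)
  also have "\<dots> = distr M M (inv_into (space M) T \<circ> T)"
    by (rule distr_distr) (auto intro: Tinv_measurable T_measurable)
  also have "\<dots> = distr M M (\<lambda>x. x)"
    by (rule distr_cong) (auto simp: Tinv_T)
  finally show ?thesis by simp
qed

lemma U_measurable [measurable]: "U i \<in> M \<rightarrow>\<^sub>M M"
  and distr_U: "distr M M (U i) = M"
  using distr_funpow_eq_self[OF T_measurable distr_T]
    distr_funpow_eq_self[OF Tinv_measurable distr_Tinv]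
  by (auto simp: Tpow_def)

lemma U_space: "x \<in> space M \<Longrightarrow> U i x \<in> space M"
  using U_measurable by (rule measurable_space)

lemma U_zero [simp]: "U 0 x = x"
  by (simp add: Tpow_def)

lemma U_succ:
  assumes "x \<in> space M"
  shows "U (i + 1) x = T (U i x)"
proof (cases "0 \<le> i")
  case True
  then have "nat (i + 1) = Suc (nat i)" by linarith
  then show ?thesis using True by (simp add: Tpow_def)
next
  case False
  define m where "m = nat (- (i + 1))"
  have m: "nat (- i) = Suc m" "i = - int m - 1" using False by (auto simp: m_def)
  have "(inv_into (space M) T ^^ m) x \<in> space M"
    by (induction m) (auto simp: assms Tinv_space)
  then have "T (U i x) = (inv_into (space M) T ^^ m) x"
    using False m(1) by (simp add: Tpow_def T_Tinv)
  also have "\<dots> = U (i + 1) x" by (auto simp: Tpow_def m(2))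
  finally show ?thesis by simp
qed

lemma U_add:
  assumes "x \<in> space M"
  shows "U (i + j) x = U i (U j x)"
proof (induction i rule: int_induct[where k = 0])
  case base
  then show ?case by simp
next
  case (step1 i)
  have "U (i + 1 + j) x = T (U (i + j) x)" using U_succ[OF assms, of "i + j"] by (simp add: ac_simps)
  also have "\<dots> = U (i + 1) (U j x)" using U_succ[OF U_space[OF assms]] step1 by simp
  finally show ?case .
next
  case (step2 i)
  have "T (U (i - 1 + j) x) = U (i + j) x" using U_succ[OF assms, of "i - 1 + j"] by simp
  also have "\<dots> = T (U (i - 1) (U j x))" using U_succ[OF U_space[OF assms], of "i - 1"] step2 by simp
  finally show ?case using Tinv_T U_space assms by metis
qed

lemma integral_U:
  fixes g :: "'a \<Rightarrow> real"
  assumes "integrable M g"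
  shows "integrable M (\<lambda>x. g (U i x))" "expectation (\<lambda>x. g (U i x)) = expectation g"
proof -
  have g: "g \<in> borel_measurable M" using assms by simp
  show "integrable M (\<lambda>x. g (U i x))"
    using integrable_distr_eq[OF U_measurable g, of i] assms by (simp add: distr_U)
  show "expectation (\<lambda>x. g (U i x)) = expectation g"
    using integral_distr[OF U_measurable g, of i] by (simp add: distr_U)
qed

text \<open>The sets \<open>V j\<close> decrease and by invariance have measure at least
  \<open>prob E\<close>, hence so does their intersection. That intersection is exactly
  \<open>T\<close>-invariant, so ergodicity gives it full measure.\<close>

lemma AE_infinitely_many_visits:
  assumes E[measurable]: "E \<in> sets M" and pos: "0 < prob E"
  shows "AE x in M. \<forall>a. \<exists>k\<ge>a. U k x \<in> E"
proof -
  define V where "V j = {x \<in> space M. \<exists>k\<ge>j. U (int k) x \<in> E}" for j :: nat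
  have V[measurable]: "V j \<in> sets M" for j unfolding V_def by measurable
  have "prob E \<le> prob (V j)" for j
  proof -
    have "prob E = measure (distr M M (U (int j))) E" by (simp add: distr_U)
    also have "\<dots> = prob (U (int j) -` E \<inter> space M)" by (simp add: measure_distr)
    also have "\<dots> \<le> prob (V j)" by (rule finite_measure_mono) (auto simp: V_def)
    finally show ?thesis .
  qed
  moreover have "decseq V" by (auto simp: V_def decseq_def) (meson order.trans)
  then have "(\<lambda>j. prob (V j)) \<longlonglongrightarrow> prob (\<Inter>j. V j)"
    by (intro finite_Lim_measure_decseq) auto
  ultimately have "prob E \<le> prob (\<Inter>j. V j)"
    by (intro LIMSEQ_le_const) auto
  then have "emeasure M (\<Inter>j. V j) \<noteq> 0" using pos by (auto simp: emeasure_eq_measure)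
  moreover have "T -` (\<Inter>j. V j) \<inter> space M = (\<Inter>j. V j)"
  proof -
    have shift: "U (int k) (T x) = U (int (Suc k)) x" if "x \<in> space M" for x k
      using U_add[OF that, of "int k" 1] U_succ[OF that, of 0] by (simp add: ac_simps)
    have "(\<forall>j. T x \<in> V j) \<longleftrightarrow> (\<forall>j. x \<in> V j)" if x: "x \<in> space M" for x
    proof
      assume L: "\<forall>j. T x \<in> V j"
      show "\<forall>j. x \<in> V j"
      proof
        fix j
        obtain k where "j \<le> k" "U (int k) (T x) \<in> E" using L by (auto simp: V_def)
        then show "x \<in> V j" using x shift[OF x, of k] by (auto simp: V_def intro!: exI[of _ "Suc k"])
      qed
    next
      assume R: "\<forall>j. x \<in> V j"
      show "\<forall>j. T x \<in> V j"
      proof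
        fix j
        have "x \<in> V (Suc j)" using R by blast
        then obtain k where "Suc j \<le> k" "U (int k) x \<in> E" by (auto simp: V_def)
        then show "T x \<in> V j" using x T_space[OF x] shift[OF x, of "k - 1"]
          by (auto simp: V_def intro!: exI[of _ "k - 1"])
      qed
    qed
    then show ?thesis by (auto simp: V_def)
  qed
  moreover have "(\<Inter>j. V j) \<in> sets M" by measurable
  ultimately have "emeasure M (\<Inter>j. V j) = emeasure M (space M)"
    using ergodic unfolding ergodic_def by blast
  then have "prob (\<Inter>j. V j) = 1" by (simp add: emeasure_space_1 measure_def)
  then have "AE x in M. x \<in> (\<Inter>j. V j)" by (intro AE_prob_1)
  then show ?thesis
  proof eventually_elim
    case (elim x)
    show ?case
    proof
      fix a :: int
      have "x \<in> V (nat a)" using elim by blast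
      then obtain k where "nat a \<le> k" "U (int k) x \<in> E" by (auto simp: V_def)
      then show "\<exists>k\<ge>a. U k x \<in> E" by (intro exI[of _ "int k"]) auto
    qed
  qed
qed

section \<open>Orbit sums as a walk on the integers\<close>

text \<open>At most one of the sums is nonempty; the subtracted one continues the walk to negative
  times, so \<open>walk_succ\<close> holds at every integer.\<close>

definition walk :: "('a \<Rightarrow> real) \<Rightarrow> 'a \<Rightarrow> int \<Rightarrow> real" where
  "walk f x j = (\<Sum>i\<in>{0..<j}. f (U i x)) - (\<Sum>i\<in>{j..<0}. f (U i x))"

lemma walk_succ: "walk f x (j + 1) = walk f x j + f (U j x)"
proof (cases "0 \<le> j")
  case True
  then have "{0..<j + 1} = insert j {0..<j}" by auto
  then show ?thesis using True by (simp add: walk_def)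
next
  case False
  then have "{j..<0} = insert j {j + 1..<0}" by auto
  then show ?thesis using False by (simp add: walk_def)
qed

text \<open>Used with \<open>c = - int n\<close> for centred averages and with \<open>c = 0\<close>
  for the gain of a jump.\<close>

lemma walk_diff:
  assumes x: "x \<in> space M"
  shows "(\<Sum>i\<in>{c..<c + int n}. f (U i (U a x))) = walk f x (c + int n + a) - walk f x (c + a)"
proof (induction n)
  case 0
  then show ?case by simp
next
  case (Suc n)
  have "{c..<c + int (Suc n)} = insert (c + int n) {c..<c + int n}" by auto
  moreover have "walk f x (c + int (Suc n) + a) = walk f x (c + int n + a) + f (U (c + int n) (U a x))"
    using walk_succ[of f x "c + int n + a"] by (simp add: U_add[OF x, symmetric] ac_simps)
  ultimately show ?case using Suc by simp
qed

lemma Bavg_U: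
  assumes "x \<in> space M"
  shows "Bavg M T f n (U k x) = (walk f x (k + int n + 1) - walk f x (k - int n)) / (2 * real n + 1)"
proof -
  have "{- int n..int n} = {- int n..<- int n + int (2 * n + 1)}" by auto
  then show ?thesis
    unfolding Bavg_def using walk_diff[OF assms, where c = "- int n" and n = "2 * n + 1" and f = f and a = k]
    by (simp add: ac_simps)
qed

lemma Bavg_measurable [measurable]:
  assumes [measurable]: "f \<in> borel_measurable M"
  shows "Bavg M T f n \<in> borel_measurable M"
proof -
  have "(\<lambda>x. (\<Sum>i\<in>{- int n..int n}. f (U i x)) / (2 * real n + 1)) \<in> borel_measurable M"
    by measurable
  then show ?thesis by (simp add: Bavg_def[abs_def])
qed

section \<open>Choice of the parameters and contradiction on a finite window\<close>

lemma eventually_positive_null: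
  fixes f :: "'a \<Rightarrow> real" and N :: nat
  assumes f [measurable]: "f \<in> borel_measurable M"
    and lim: "AE x in M. (\<lambda>n. Bavg M T f n x) \<longlonglongrightarrow> 0"
  defines "E \<equiv> {x \<in> space M. \<forall>n>N. 0 < Bavg M T f n x}"
  shows "prob E = 0"
proof (rule ccontr)
  assume "prob E \<noteq> 0"
  then have pos: "0 < prob E" by (simp add: zero_less_measure_iff)
  have E [measurable]: "E \<in> sets M" unfolding E_def by measurable
  have visits: "AE x in M. \<forall>a. \<exists>k\<ge>a. U k x \<in> E"
    by (rule AE_infinitely_many_visits[OF E pos])
  \<comment> \<open>The block of radius \<open>k - a\<close> about \<open>k\<close> has end points
    \<open>a\<close> and \<open>2 * k + 1 - a\<close>. Its radius must exceed \<open>N\<close>,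
    hence \<open>Suc N\<close>.\<close>
  have reflect: "walk f x a < walk f x (2 * k + 1 - a)"
    if "x \<in> space M" "U k x \<in> E" "a + int (Suc N) \<le> k" for x a k
  proof -
    define n where "n = nat (k - a)"
    have n: "int n = k - a" "N < n" using that by (auto simp: n_def)
    have "0 < Bavg M T f n (U k x)" using that(2) n(2) by (auto simp: E_def)
    then show ?thesis unfolding Bavg_U[OF that(1)] n(1)
      by (simp add: zero_less_divide_iff algebra_simps)
  qed

  define P where "P D = {x \<in> space M. \<forall>k. Suc N \<le> k \<and> k \<le> D \<longrightarrow> U (int k) x \<notin> E}" for D
  have P [measurable]: "P D \<in> sets M" for D unfolding P_def by measurable
  have "AE x in M. eventually (\<lambda>D. x \<notin> P D) sequentially"
    using visits
  proof eventually_elim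
    case (elim x)
    then obtain k where k: "int (Suc N) \<le> k" "U k x \<in> E" by blast
    then have "x \<notin> P D" if "nat k \<le> D" for D
      using that by (auto simp: P_def intro!: exI[of _ "nat k"])
    then show ?case by (auto simp: eventually_sequentially)
  qed
  from exists_prob_less[of P, OF P this, of "1 / 1200" "Suc N"]
  obtain D where D: "Suc N \<le> D" "prob (P D) < 1 / 1200" by auto

  \<comment> \<open>Points from which some admissible short reflection gains at most
    \<open>1 / Suc j\<close>. The form \<open>0 + int (2 * k + 1)\<close> matches
    \<open>walk_diff\<close> with \<open>c = 0\<close>.\<close>
  define H where "H j = {x \<in> space M. \<exists>k. Suc N \<le> k \<and> k \<le> 2 * D \<and> U (int k) x \<in> E \<and>
    (\<Sum>i\<in>{0..<0 + int (2 * k + 1)}. f (U i x)) \<le> 1 / real (Suc j)}" for j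
  have H [measurable]: "H j \<in> sets M" for j unfolding H_def by measurable
  \<comment> \<open>Only finitely many \<open>k\<close> compete and each has a strictly positive
    gain, so this holds at every point.\<close>
  have "eventually (\<lambda>j. x \<notin> H j) sequentially" if x: "x \<in> space M" for x
  proof -
    let ?s = "\<lambda>k. \<Sum>i\<in>{0..<0 + int (2 * k + 1)}. f (U i x)"
    have "\<forall>k\<in>{Suc N..2 * D}. eventually (\<lambda>j. U (int k) x \<in> E \<longrightarrow> 1 / real (Suc j) < ?s k) sequentially"
    proof
      fix k assume k: "k \<in> {Suc N..2 * D}"
      show "eventually (\<lambda>j. U (int k) x \<in> E \<longrightarrow> 1 / real (Suc j) < ?s k) sequentially"
      proof (cases "U (int k) x \<in> E")
        case True
        have "?s k = walk f x (2 * int k + 1) - walk f x 0"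
          using walk_diff[OF x, where c = 0 and a = 0 and n = "2 * k + 1" and f = f]
          by (simp add: ac_simps)
        then have "0 < ?s k" using reflect[OF x True, of 0] k by simp
        with LIMSEQ_inverse_real_of_nat
        have "eventually (\<lambda>j. inverse (real (Suc j)) < ?s k) sequentially"
          by (rule order_tendstoD(2))
        then show ?thesis by (simp add: inverse_eq_divide)
      qed simp
    qed
    then have "eventually (\<lambda>j. \<forall>k\<in>{Suc N..2 * D}. U (int k) x \<in> E \<longrightarrow> 1 / real (Suc j) < ?s k) sequentially"
      by (intro eventually_ball_finite) auto
    then show ?thesis
      by eventually_elim (force simp: H_def)
  qed
  then have "AE x in M. eventually (\<lambda>j. x \<notin> H j) sequentially" by (rule AE_I2)
  from exists_prob_less[of H, OF H this, of "1 / (1000 * real D)" 0]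
  obtain j where j: "prob (H j) < 1 / (1000 * real D)" using D by auto

  define \<eta> where "\<eta> = 1 / real (Suc j)"
  \<comment> \<open>This is \<open>rate / 64\<close>, below the threshold \<open>rate / 32\<close>
    of \<open>no_small_reflections\<close>.\<close>
  define \<epsilon> where "\<epsilon> = \<eta> / (5 * real D) / 64"
  have \<eta>: "0 < \<eta>" by (simp add: \<eta>_def)
  have \<epsilon>: "0 < \<epsilon>" using D \<eta> by (simp add: \<epsilon>_def)

  define G where "G m = {x \<in> space M. \<exists>n\<ge>m. \<epsilon> < \<bar>Bavg M T f n x\<bar>}" for m
  have G [measurable]: "G m \<in> sets M" for m unfolding G_def by measurable
  have "AE x in M. eventually (\<lambda>m. x \<notin> G m) sequentially"
    using lim
  proof eventually_elim
    case (elim x)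
    then have "eventually (\<lambda>n. \<bar>Bavg M T f n x\<bar> < \<epsilon>) sequentially"
      using \<epsilon> by (auto simp: tendsto_iff)
    then obtain m where m: "\<forall>n\<ge>m. \<not> \<epsilon> < \<bar>Bavg M T f n x\<bar>"
      by (auto simp: eventually_sequentially not_less intro: less_imp_le)
    have "x \<notin> G m'" if "m \<le> m'" for m'
      using m order.trans[OF that] by (auto simp: G_def)
    then show ?case by (auto simp: eventually_sequentially)
  qed
  from exists_prob_less[of G, OF G this, of "1 / 200" 0]
  obtain m where m: "prob (G m) < 1 / 200" by auto

  \<comment> \<open>The first two weights are the penalties required by
    \<open>reflected_walk\<close>; weight 1 on \<open>G m\<close> makes \<open>\<phi> < 1\<close>
    exclude that set.\<close>
  define \<phi> :: "'a \<Rightarrow> real" where "\<phi> x = 6 * indicator (P D) x + 5 * real D * indicator (H j) x + indicator (G m) x" for x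
  have ind: "integrable M (indicator A :: 'a \<Rightarrow> real)" if "A \<in> sets M" for A
    using that by (intro integrable_real_indicator) (auto simp: less_top[symmetric])
  have int: "integrable M \<phi>"
    unfolding \<phi>_def by (intro Bochner_Integration.integrable_add integrable_mult_right ind P H G)
  \<comment> \<open>Each of the three terms has mean below \<open>1 / 200\<close>, and
    \<open>3 / 200 < 1 / 64\<close>.\<close>
  have "5 * real D * prob (H j) < 1 / 200" using j D by (simp add: field_simps)
  moreover have "expectation \<phi> = 6 * prob (P D) + 5 * real D * prob (H j) + prob (G m)"
    unfolding \<phi>_def by (simp add: ind)
  ultimately have exp: "expectation \<phi> \<le> 1 / 64" using D(2) m by simp

  define L where "L = 160 * int D + 8 * (int m + 1)"
  have "integrable M (\<lambda>x. \<Sum>i\<in>{-L..<L}. \<phi> (U i x))"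
    by (intro Bochner_Integration.integrable_sum integral_U(1) int)
  then obtain x where x: "x \<in> space M" "\<forall>a. \<exists>k\<ge>a. U k x \<in> E"
    "(\<Sum>i\<in>{-L..<L}. \<phi> (U i x)) \<le> expectation (\<lambda>x. \<Sum>i\<in>{-L..<L}. \<phi> (U i x))"
    using visits by (rule exists_le_expectation)
  \<comment> \<open>By invariance all \<open>2 * L\<close> translates have the same mean, which
    yields \<open>L / 32\<close>.\<close>
  have "expectation (\<lambda>x. \<Sum>i\<in>{-L..<L}. \<phi> (U i x)) = 2 * real_of_int L * expectation \<phi>"
    by (simp add: integral_U[OF int] L_def)
  also have "\<dots> \<le> 2 * real_of_int L * (1 / 64)"
    using exp by (intro mult_left_mono) (auto simp: L_def)
  finally have tot: "(\<Sum>i\<in>{-L..<L}. \<phi> (U i x)) \<le> L / 32" using x(3) by simp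

  interpret reflected_walk "walk f x" "\<lambda>i. \<phi> (U i x)" "{k. U k x \<in> E}" "int (Suc N)" "int D" \<eta>
  proof
    show "walk f x a < walk f x (2 * k + 1 - a)"
      if "k \<in> {k. U k x \<in> E}" "a + int (Suc N) \<le> k" for k a
      using reflect[OF x(1)] that by simp
    show "\<exists>k\<in>{k. U k x \<in> E}. a \<le> k" for a using x(2) by blast
    show "0 \<le> \<phi> (U a x)" for a by (simp add: \<phi>_def)
    show "6 \<le> \<phi> (U a x)"
      if "\<And>k. a + int (Suc N) \<le> k \<Longrightarrow> k \<le> a + int D \<Longrightarrow> k \<notin> {k. U k x \<in> E}" for a
    proof -
      have "U a x \<in> P D"
        unfolding P_def using that U_space[OF x(1)] by (auto simp: U_add[OF x(1), symmetric])
      then show ?thesis by (simp add: \<phi>_def)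
    qed
    show "5 * real_of_int (int D) \<le> \<phi> (U a x)"
      if k: "k \<in> {k. U k x \<in> E}" "a + int (Suc N) \<le> k" "k \<le> a + 2 * int D"
        "walk f x (2 * k + 1 - a) - walk f x a \<le> \<eta>" for a k
    proof -
      define n where "n = nat (k - a)"
      have n: "int n = k - a" "Suc N \<le> n" "n \<le> 2 * D" using k by (auto simp: n_def)
      have "U (int n) (U a x) \<in> E" using k(1) by (simp add: n(1) U_add[OF x(1), symmetric])
      moreover have "(\<Sum>i\<in>{0..<0 + int (2 * n + 1)}. f (U i (U a x))) \<le> 1 / real (Suc j)"
      proof -
        have "0 + int (2 * n + 1) + a = 2 * k + 1 - a" using n(1) by simp
        then show ?thesis
          using k(4) unfolding walk_diff[OF x(1)] \<eta>_def by (simp only: add_0)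
      qed
      ultimately have "U a x \<in> H j"
        unfolding H_def using n(2,3) U_space[OF x(1)] by blast
      then show ?thesis by (simp add: \<phi>_def)
    qed
  qed (use D \<eta> in auto)
  show False
  proof (rule no_small_reflections[where L = L and m = m and \<epsilon> = \<epsilon>])
    show "\<epsilon> < rate / 32" using rate_pos by (simp add: \<epsilon>_def rate_def)
    show "\<bar>walk f x (k + int n + 1) - walk f x (k - int n)\<bar> \<le> \<epsilon> * (2 * real n + 1)"
      if "\<phi> (U k x) < 1" "m \<le> n" for k n
    proof -
      have "U k x \<notin> G m"
      proof
        assume "U k x \<in> G m"
        then have "1 \<le> \<phi> (U k x)" by (simp add: \<phi>_def)
        then show False using that(1) by simp
      qed
      then have "\<bar>Bavg M T f n (U k x)\<bar> \<le> \<epsilon>"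
        using that(2) U_space[OF x(1)] by (force simp: G_def)
      then show ?thesis unfolding Bavg_U[OF x(1)]
        by (simp add: abs_divide pos_divide_le_eq)
    qed
  qed (use \<epsilon> tot in \<open>auto simp: L_def\<close>)
qed

lemma Bavg_affine: "Bavg M T (\<lambda>x. s * (f x - c)) n x = s * (Bavg M T f n x - c)"
  by (simp add: Bavg_def sum_subtractf sum_distrib_left[symmetric] field_simps)

text \<open>Centring at \<open>c\<close> reduces to limit 0, and the factor \<open>s\<close>, later
  \<open>1\<close> and \<open>-1\<close>, treats both signs at once. The union over \<open>N\<close>
  is countable.\<close>

lemma eventually_one_sided_null:
  assumes f [measurable]: "f \<in> borel_measurable M"
    and lim: "AE x in M. (\<lambda>n. Bavg M T f n x) \<longlonglongrightarrow> c"
  shows "emeasure M (\<Union>N\<in>{0::nat<..}. \<Inter>n\<in>{N<..}. {x \<in> space M. 0 < s * (Bavg M T f n x - c)}) = 0"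
proof -
  have "AE x in M. (\<lambda>n. Bavg M T (\<lambda>x. s * (f x - c)) n x) \<longlonglongrightarrow> 0"
    using lim
  proof eventually_elim
    case (elim x)
    have "(\<lambda>n. s * (Bavg M T f n x - c)) \<longlonglongrightarrow> s * (c - c)"
      by (intro tendsto_intros elim)
    then show ?case by (simp add: Bavg_affine)
  qed
  then have null: "prob {x \<in> space M. \<forall>n>N. 0 < s * (Bavg M T f n x - c)} = 0" for N
    using eventually_positive_null[of "\<lambda>x. s * (f x - c)" N] by (simp add: Bavg_affine)
  have "(\<Union>N\<in>{0::nat<..}. {x \<in> space M. \<forall>n>N. 0 < s * (Bavg M T f n x - c)}) \<in> null_sets M"
    by (intro null_sets_UN' countableI_type null_setsI) (simp_all add: emeasure_eq_measure null)
  moreover have "(\<Inter>n\<in>{N<..}. {x \<in> space M. 0 < s * (Bavg M T f n x - c)}) =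
      {x \<in> space M. \<forall>n>N. 0 < s * (Bavg M T f n x - c)}" for N :: nat
    by auto
  ultimately show ?thesis by (simp add: null_setsD1)
qed

end

theorem theorem4:
  fixes M :: "'a measure" and T :: "'a \<Rightarrow> 'a" and f :: "'a \<Rightarrow> real" and c :: real
  assumes "prob_space M"
    and "inv_mp M T"
    and "ergodic M T"
    and "f \<in> borel_measurable M"
    and "AE x in M. (\<lambda>n. Bavg M T f n x) \<longlonglongrightarrow> c"
  shows "emeasure M (\<Union>N\<in>{0::nat<..}. \<Inter>n\<in>{N<..}. {x \<in> space M. Bavg M T f n x > c}) = 0 \<and>
         emeasure M (\<Union>N\<in>{0::nat<..}. \<Inter>n\<in>{N<..}. {x \<in> space M. Bavg M T f n x < c}) = 0"
proof -
  interpret prob_space M by (rule assms(1))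
  interpret invertible_ergodic M T by unfold_locales (rule assms)+
  show ?thesis
    using eventually_one_sided_null[OF assms(4,5), of 1] eventually_one_sided_null[OF assms(4,5), of "-1"]
    by simp
qed

end
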